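(* If $\vdash G\triangleright N$, $G$ is bounded and $G\parallel\mathcal M$ is balanced, then the session $N\parallel\mathcal M$ has the progress property.
   Context: Participants $\mathsf p,\mathsf q,\mathsf r,\mathsf s$; labels $\lambda$. Processes are the possibly infinite but regular terms coinductively generated by $P ::= \mathbf 0 \mid \mathsf p!\{\lambda_i;P_i\}_{i\in I}\mid \mathsf p?\{\lambda_i;P_i\}_{i\in I}$, $I$ finite nonempty, $\lambda_i$ pairwise distinct. A network is $N=\mathsf p_1[\![P_1]\!]\parallel\cdots\parallel\mathsf p_n[\![P_n]\!]$ with $n>0$ and pairwise distinct $\mathsf p_i$, taken modulo permutation and adding/removing components $\mathsf p[\![\mathbf 0]\!]$; we write $\mathsf p[\![P]\!]\in N$ ($P\neq\mathbf 0$) if $N\equiv\mathsf p[\![P]\!]\parallel N'$, and $\mathrm{plays}(N)=\{\mathsf p\mid\mathsf p[\![P]\!]\in N\}$. A message is $\langle\mathsf p,\lambda,\mathsf q\rangle$; a queue $\mathcal M$ is a finite sequence of messages ($\emptyset$, $\cdot$), modulo the congruence $\equiv$ generated by $\langle\mathsf p,\lambda,\mathsf q\rangle\cdot\langle\mathsf r,\lambda',\mathsf s\rangle\equiv\langle\mathsf r,\lambda',\mathsf s\rangle\cdot\langle\mathsf p,\lambda,\mathsf q\rangle$ when $\mathsf p\neq\mathsf r$ or $\mathsf q\neq\mathsf s$. Communications $\beta::=\mathsf p\mathsf q!\lambda\mid\mathsf p\mathsf q?\lambda$ (the latter: input by $\mathsf q$ of $\lambda$ from $\mathsf p$), $\mathrm{play}(\mathsf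 p\mathsf q!\lambda)=\mathsf p$, $\mathrm{play}(\mathsf p\mathsf q?\lambda)=\mathsf q$. Sessions $N\parallel\mathcal M$ reduce by: $\mathsf p[\![\mathsf q!\{\lambda_i;P_i\}_{i\in I}]\!]\parallel N\parallel\mathcal M\xrightarrow{\mathsf p\mathsf q!\lambda_h}\mathsf p[\![P_h]\!]\parallel N\parallel\mathcal M\cdot\langle\mathsf p,\lambda_h,\mathsf q\rangle$ and $\mathsf q[\![\mathsf p?\{\lambda_i;Q_i\}_{i\in I}]\!]\parallel N\parallel\langle\mathsf p,\lambda_h,\mathsf q\rangle\cdot\mathcal M\xrightarrow{\mathsf p\mathsf q?\lambda_h}\mathsf q[\![Q_h]\!]\parallel N\parallel\mathcal M$, $h\in I$. Lockstep: a nonempty set $\Delta$ of communications is coherent for a session $S$ if distinct elements of $\Delta$ have distinct players and $S$ has a $\beta$-transition for each $\beta\in\Delta$; $S\Rightarrow_\Delta S'$ if $\Delta=\{\beta_1,\ldots,\beta_n\}$ is a maximal coherent set for $S$ and $S\xrightarrow{\beta_1}\cdots\xrightarrow{\beta_n}S'$. A lockstep derivative of $S$ is any session reachable by finitely many (possibly zero) lockstep transitions. A complete lockstep computation from $S$ is a sequence $S=S_0\Rightarrow_{\Delta_0}S_1\Rightarrow_{\Delta_1}\cdots$ which is infinite or finite with last session having no transition. A session $N\parallel\mathcal M$ is terminated if $N\equiv\mathsf p[\![\mathbf 0]\!]$ and $\mathcal M=\emptyset$, and deadlocked if it has no transition and is not terminated. It is input-enabling if whenever $\mathsf p[\![\mathsf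 q?\{\lambda_i;P_i\}_{i\in I}]\!]\in N$, every complete lockstep computation from it has a step $h$ with $\mathsf q\mathsf p?\lambda_j\in\Delta_h$ for some $j\in I$; it is queue-consuming if whenever $\mathcal M\equiv\langle\mathsf p,\lambda,\mathsf q\rangle\cdot\mathcal M'$, every complete lockstep computation from it has a step $h$ with $\mathsf p\mathsf q?\lambda\in\Delta_h$. A session has the progress property if none of its lockstep derivatives is deadlocked, and all its lockstep derivatives are input-enabling and queue-consuming. Global types: possibly infinite regular terms $G ::= \mathsf{End}\mid \mathsf p\mathsf q!\{\lambda_i;G_i\}_{i\in I}\mid\mathsf p\mathsf q?\{\lambda_i;G_i\}_{i\in I}$ ($I$ finite nonempty, $\mathsf p\neq\mathsf q$, $\lambda_i$ distinct); $\mathsf p\mathsf q\dagger$ denotes either form. $\mathrm{play}(\mathsf p\mathsf q!\{\ldots\})=\mathsf p$, $\mathrm{play}(\mathsf p\mathsf q?\{\ldots\})=\mathsf q$; $\mathrm{plays}(G)$ least set with $\mathrm{plays}(\mathsf{End})=\emptyset$, $\mathrm{plays}(G)=\{\mathrm{play}(G)\}\cup\bigcup_i\mathrm{plays}(G_i)$. Typing $\vdash G\triangleright N$ (coinductive): (End) $\vdash\mathsf{End}\triangleright\mathsf p[\![\mathbf 0]\!]$; (Out) if $\forall i\in I$: $\vdash G_i\triangleright\mathsf p[\![P_i]\!]\parallel N$ and $\mathrm{plays}(G_i)\setminus\{\mathsf p\}=\mathrm{plays}(N)$, then $\vdash\mathsf p\mathsf q!\{\lambda_i;G_i\}_{i\in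 I}\triangleright\mathsf p[\![\mathsf q!\{\lambda_i;P_i\}_{i\in I}]\!]\parallel N$; (In) if $I\subseteq J$ and $\forall i\in I$: $\vdash G_i\triangleright\mathsf p[\![P_i]\!]\parallel N$ and $\mathrm{plays}(G_i)\setminus\{\mathsf p\}=\mathrm{plays}(N)$, then $\vdash\mathsf q\mathsf p?\{\lambda_i;G_i\}_{i\in I}\triangleright\mathsf p[\![\mathsf q?\{\lambda_j;P_j\}_{j\in J}]\!]\parallel N$. Boundedness: $\mathrm{Paths}(G)$ is the greatest family with $\mathrm{Paths}(\mathsf{End})=\{\epsilon\}$ and $\mathrm{Paths}(\mathsf p\mathsf q\dagger\{\lambda_i;G_i\}_{i\in I})=\bigcup_{i}\{\mathsf p\mathsf q\dagger\lambda_i\cdot\xi\mid\xi\in\mathrm{Paths}(G_i)\}$; $\mathrm{depth}(\xi,\mathsf p)=\inf\{n\mid\mathrm{play}(\xi_n)=\mathsf p\}$ ($\inf\emptyset=\infty$); $\mathrm{depth}(G,\mathsf p)=1+\sup\{\mathrm{depth}(\xi,\mathsf p)\mid\xi\in\mathrm{Paths}(G)\}$ if $\mathsf p\in\mathrm{plays}(G)$, else $0$. $G$ is bounded if $\mathrm{depth}(G',\mathsf p)<\infty$ for all $G'$ occurring in $G$ and all $\mathsf p\in\mathrm{plays}(G')$. Readability $\mathrm{read}(G,\mathcal M)$ (inductive): $\mathrm{read}(G,\emptyset)$; $\mathrm{read}(\mathsf p\mathsf q!\{\lambda_i;G_i\}_{i\in I},\mathcal M)$ if $\mathrm{read}(G_i,\mathcal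 M)$ $\forall i$; $\mathrm{read}(\mathsf p\mathsf q?\{\lambda_i;G_i\}_{i\in I},\langle\mathsf p,\lambda_h,\mathsf q\rangle\cdot\mathcal M)$ if $h\in I$ and $\mathrm{read}(G_i,\mathcal M)$ $\forall i$; $\mathrm{read}(\mathsf p\mathsf q?\{\lambda_i;G_i\}_{i\in I},\mathcal M)$ if $\mathcal M\not\equiv\langle\mathsf p,\lambda_i,\mathsf q\rangle\cdot\mathcal M'$ for all $i\in I$, $\mathcal M'$, and $\mathrm{read}(G_i,\mathcal M)$ $\forall i$. Balancing (coinductive): $\mathsf{End}\parallel\emptyset$ is balanced; $G=\mathsf p\mathsf q!\{\lambda_i;G_i\}_{i\in I}$ with $\mathcal M$ is balanced if $\mathrm{read}(G,\mathcal M)$ and each $G_i\parallel\mathcal M\cdot\langle\mathsf p,\lambda_i,\mathsf q\rangle$ is balanced; $G=\mathsf p\mathsf q?\{\lambda_i;G_i\}_{i\in I}$ with $\langle\mathsf p,\lambda_h,\mathsf q\rangle\cdot\mathcal M$, $h\in I$, is balanced if $\mathrm{read}(G,\langle\mathsf p,\lambda_h,\mathsf q\rangle\cdot\mathcal M)$ and $G_h\parallel\mathcal M$ is balanced. *)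

theory Defs
  imports Main "HOL-Library.Finite_Map" "HOL-Library.Extended_Nat"
begin

text \<open>Participants range over the type variable \<open>'p\<close> and labels over \<open>'l\<close>.  A choice with finitely
  many pairwise distinct labels is a finite map from labels to continuations.\<close>

subsection \<open>Processes and networks\<close>

codatatype ('p, 'l) process =
    Inact
  | Send 'p (branches: "('l, ('p, 'l) process) fmap")
  | Recv 'p (branches: "('l, ('p, 'l) process) fmap")
where
  "branches Inact = fmempty"

inductive subprocess :: "('p, 'l) process \<Rightarrow> ('p, 'l) process \<Rightarrow> bool" for P where
  subprocess_refl: "subprocess P P"
| subprocess_step: "subprocess P Q \<Longrightarrow> fmlookup (branches Q) l = Some R \<Longrightarrow> subprocess P R"

text \<open>The codatatype also contains terms with empty choices and non-regular terms; these are not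
  processes.  \<open>subprocess P Q\<close> says that \<open>Q\<close> occurs in \<open>P\<close>, and regularity means that only finitely
  many terms occur.\<close>

definition wf_process :: "('p, 'l) process \<Rightarrow> bool" where
  "wf_process P \<longleftrightarrow>
     finite {Q. subprocess P Q} \<and>
     (\<forall>Q. subprocess P Q \<longrightarrow> Q \<noteq> Inact \<longrightarrow> branches Q \<noteq> fmempty)"

text \<open>Modulo permutation of components and addition or removal of inactive components, a network is
  the function that assigns to every participant its process, \<open>Inact\<close> for all but finitely many.
  With \<open>p[[P]] || N\<close> written as \<open>N(p := P)\<close>, the network \<open>p[[0]]\<close> is \<open>\<lambda>_. Inact\<close>.\<close>

type_synonym ('p, 'l) network = "'p \<Rightarrow> ('p, 'l) process"

definition plays_net :: "('p, 'l) network \<Rightarrow> 'p set" where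
  "plays_net N = {p. N p \<noteq> Inact}"

definition wf_network :: "('p, 'l) network \<Rightarrow> bool" where
  "wf_network N \<longleftrightarrow> finite (plays_net N) \<and> (\<forall>p. wf_process (N p))"


subsection \<open>Messages and queues\<close>

text \<open>The triple \<open>(p, l, q)\<close> is the message with label \<open>l\<close> from \<open>p\<close> to \<open>q\<close>.\<close>

type_synonym ('p, 'l) message = "'p \<times> 'l \<times> 'p"

inductive queue_cong :: "('p, 'l) message list \<Rightarrow> ('p, 'l) message list \<Rightarrow> bool" where
  queue_cong_swap: "p \<noteq> r \<or> q \<noteq> s \<Longrightarrow>
    queue_cong (ms @ [(p, l, q), (r, l', s)] @ ms') (ms @ [(r, l', s), (p, l, q)] @ ms')"
| queue_cong_refl: "queue_cong ms ms"
| queue_cong_sym: "queue_cong ms ms' \<Longrightarrow> queue_cong ms' ms"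
| queue_cong_trans: "queue_cong ms ms' \<Longrightarrow> queue_cong ms' ms'' \<Longrightarrow> queue_cong ms ms''"

lemma queue_cong_append_left: "queue_cong ms ms' \<Longrightarrow> queue_cong (ns @ ms) (ns @ ms')"
proof (induction rule: queue_cong.induct)
  case (queue_cong_swap p r q s ms l l' ms')
  then show ?case
    using queue_cong.queue_cong_swap[of p r q s "ns @ ms" l l' ms'] by simp
qed (auto intro: queue_cong.intros)

lemma queue_cong_append_right: "queue_cong ms ms' \<Longrightarrow> queue_cong (ms @ ns) (ms' @ ns)"
proof (induction rule: queue_cong.induct)
  case (queue_cong_swap p r q s ms l l' ms')
  then show ?case
    using queue_cong.queue_cong_swap[of p r q s ms l l' "ms' @ ns"] by simp
qed (auto intro: queue_cong.intros)

quotient_type ('p, 'l) queue = "('p, 'l) message list" / queue_cong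
  by (rule equivpI)
    (auto simp: reflp_def symp_def transp_def intro: queue_cong.intros)

lift_definition empty_queue :: "('p, 'l) queue" is "[]" .

lift_definition enqueue :: "('p, 'l) queue \<Rightarrow> ('p, 'l) message \<Rightarrow> ('p, 'l) queue"
  is "\<lambda>ms m. ms @ [m]"
  by (rule queue_cong_append_right)

lift_definition queue_cons :: "('p, 'l) message \<Rightarrow> ('p, 'l) queue \<Rightarrow> ('p, 'l) queue"
  is "\<lambda>m ms. [m] @ ms"
  by (rule queue_cong_append_left)


subsection \<open>Sessions and their transitions\<close>

text \<open>\<open>OutC p q l\<close> is \<open>pq!l\<close>, played by \<open>p\<close>; \<open>InC p q l\<close> is \<open>pq?l\<close>, played by \<open>q\<close>, who
  receives from \<open>p\<close>.\<close>

datatype ('p, 'l) comm = OutC 'p 'p 'l | InC 'p 'p 'l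

fun play :: "('p, 'l) comm \<Rightarrow> 'p" where
  "play (OutC p q l) = p"
| "play (InC p q l) = q"

type_synonym ('p, 'l) session = "('p, 'l) network \<times> ('p, 'l) queue"

inductive session_step :: "('p, 'l) session \<Rightarrow> ('p, 'l) comm \<Rightarrow> ('p, 'l) session \<Rightarrow> bool" where
  step_out: "N p = Send q Ps \<Longrightarrow> fmlookup Ps l = Some P \<Longrightarrow>
    session_step (N, M) (OutC p q l) (N(p := P), enqueue M (p, l, q))"
| step_in: "N q = Recv p Qs \<Longrightarrow> fmlookup Qs l = Some Q \<Longrightarrow>
    session_step (N, queue_cons (p, l, q) M) (InC p q l) (N(q := Q), M)"

definition no_transition :: "('p, 'l) session \<Rightarrow> bool" where
  "no_transition S \<longleftrightarrow> \<not> (\<exists>\<beta> S'. session_step S \<beta> S')"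

inductive trans_seq :: "('p, 'l) session \<Rightarrow> ('p, 'l) comm list \<Rightarrow> ('p, 'l) session \<Rightarrow> bool" where
  trans_seq_Nil: "trans_seq S [] S"
| trans_seq_Cons: "session_step S \<beta> S' \<Longrightarrow> trans_seq S' \<beta>s S'' \<Longrightarrow> trans_seq S (\<beta> # \<beta>s) S''"


subsection \<open>Lockstep semantics and progress\<close>

definition coherent :: "('p, 'l) session \<Rightarrow> ('p, 'l) comm set \<Rightarrow> bool" where
  "coherent S \<Delta> \<longleftrightarrow> \<Delta> \<noteq> {} \<and> inj_on play \<Delta> \<and> (\<forall>\<beta>\<in>\<Delta>. \<exists>S'. session_step S \<beta> S')"

definition max_coherent :: "('p, 'l) session \<Rightarrow> ('p, 'l) comm set \<Rightarrow> bool" where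
  "max_coherent S \<Delta> \<longleftrightarrow> coherent S \<Delta> \<and> (\<forall>\<Delta>'. coherent S \<Delta>' \<longrightarrow> \<Delta> \<subseteq> \<Delta>' \<longrightarrow> \<Delta>' = \<Delta>)"

definition lockstep :: "('p, 'l) session \<Rightarrow> ('p, 'l) comm set \<Rightarrow> ('p, 'l) session \<Rightarrow> bool" where
  "lockstep S \<Delta> S' \<longleftrightarrow>
     max_coherent S \<Delta> \<and> (\<exists>\<beta>s. distinct \<beta>s \<and> set \<beta>s = \<Delta> \<and> trans_seq S \<beta>s S')"

definition lockstep_derivative :: "('p, 'l) session \<Rightarrow> ('p, 'l) session \<Rightarrow> bool" where
  "lockstep_derivative = (\<lambda>S S'. \<exists>\<Delta>. lockstep S \<Delta> S')\<^sup>*\<^sup>*"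

text \<open>\<open>n\<close> is the number of steps, \<open>\<infinity>\<close> for an infinite computation; \<open>\<sigma>\<close> and \<open>\<delta>\<close> are irrelevant
  beyond it.\<close>

definition complete_lockstep ::
  "('p, 'l) session \<Rightarrow> (nat \<Rightarrow> ('p, 'l) session) \<Rightarrow> (nat \<Rightarrow> ('p, 'l) comm set) \<Rightarrow> enat \<Rightarrow> bool" where
  "complete_lockstep S \<sigma> \<delta> n \<longleftrightarrow>
     \<sigma> 0 = S \<and>
     (\<forall>h. enat h < n \<longrightarrow> lockstep (\<sigma> h) (\<delta> h) (\<sigma> (Suc h))) \<and>
     (\<forall>k. n = enat k \<longrightarrow> no_transition (\<sigma> k))"

definition terminated :: "('p, 'l) session \<Rightarrow> bool" where
  "terminated S \<longleftrightarrow> S = ((\<lambda>_. Inact), empty_queue)"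

definition deadlocked :: "('p, 'l) session \<Rightarrow> bool" where
  "deadlocked S \<longleftrightarrow> no_transition S \<and> \<not> terminated S"

definition input_enabling :: "('p, 'l) session \<Rightarrow> bool" where
  "input_enabling S \<longleftrightarrow>
     (\<forall>p q Ps. fst S p = Recv q Ps \<longrightarrow>
       (\<forall>\<sigma> \<delta> n. complete_lockstep S \<sigma> \<delta> n \<longrightarrow>
         (\<exists>h l. enat h < n \<and> l |\<in>| fmdom Ps \<and> InC q p l \<in> \<delta> h)))"

definition queue_consuming :: "('p, 'l) session \<Rightarrow> bool" where
  "queue_consuming S \<longleftrightarrow>
     (\<forall>p l q M'. snd S = queue_cons (p, l, q) M' \<longrightarrow>
       (\<forall>\<sigma> \<delta> n. complete_lockstep S \<sigma> \<delta> n \<longrightarrow>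
         (\<exists>h. enat h < n \<and> InC p q l \<in> \<delta> h)))"

definition progress :: "('p, 'l) session \<Rightarrow> bool" where
  "progress S \<longleftrightarrow>
     (\<forall>S'. lockstep_derivative S S' \<longrightarrow>
       \<not> deadlocked S' \<and> input_enabling S' \<and> queue_consuming S')"


subsection \<open>Global types\<close>

text \<open>\<open>GOut p q Gs\<close> is \<open>pq!{..}\<close>, played by \<open>p\<close>; \<open>GIn p q Gs\<close> is \<open>pq?{..}\<close>, played by \<open>q\<close>.\<close>

codatatype ('p, 'l) gtype =
    End
  | GOut 'p 'p (gbranches: "('l, ('p, 'l) gtype) fmap")
  | GIn 'p 'p (gbranches: "('l, ('p, 'l) gtype) fmap")
where
  "gbranches End = fmempty"

inductive subtype :: "('p, 'l) gtype \<Rightarrow> ('p, 'l) gtype \<Rightarrow> bool" for G where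
  subtype_refl: "subtype G G"
| subtype_step: "subtype G G' \<Longrightarrow> fmlookup (gbranches G') l = Some G'' \<Longrightarrow> subtype G G''"

text \<open>\<open>subtype G G'\<close> says that \<open>G'\<close> occurs in \<open>G\<close>.\<close>

definition wf_gtype :: "('p, 'l) gtype \<Rightarrow> bool" where
  "wf_gtype G \<longleftrightarrow>
     finite {G'. subtype G G'} \<and>
     (\<forall>p q Gs. subtype G (GOut p q Gs) \<or> subtype G (GIn p q Gs) \<longrightarrow> p \<noteq> q \<and> Gs \<noteq> fmempty)"


inductive plays_in :: "'p \<Rightarrow> ('p, 'l) gtype \<Rightarrow> bool" where
  plays_in_GOut: "plays_in p (GOut p q Gs)"
| plays_in_GIn: "plays_in q (GIn p q Gs)"
| plays_in_branch: "fmlookup (gbranches G) l = Some G' \<Longrightarrow> plays_in r G' \<Longrightarrow> plays_in r G"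

definition plays :: "('p, 'l) gtype \<Rightarrow> 'p set" where
  "plays G = {p. plays_in p G}"


subsection \<open>Typing\<close>

text \<open>Here \<open>N\<close> is the whole network: the component \<open>p[[P]]\<close> in front of the rest is \<open>N p = P\<close>, and
  the players of the rest are \<open>plays_net N - {p}\<close>.\<close>

coinductive typed :: "('p, 'l) gtype \<Rightarrow> ('p, 'l) network \<Rightarrow> bool" where
  typed_End: "typed End (\<lambda>_. Inact)"
| typed_Out: "N p = Send q Ps \<Longrightarrow> fmdom Gs = fmdom Ps \<Longrightarrow>
    (\<forall>l G P. fmlookup Gs l = Some G \<longrightarrow> fmlookup Ps l = Some P \<longrightarrow>
       typed G (N(p := P)) \<and> plays G - {p} = plays_net N - {p}) \<Longrightarrow>
    typed (GOut p q Gs) N"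
| typed_In: "N p = Recv q Ps \<Longrightarrow> fmdom Gs |\<subseteq>| fmdom Ps \<Longrightarrow>
    (\<forall>l G P. fmlookup Gs l = Some G \<longrightarrow> fmlookup Ps l = Some P \<longrightarrow>
       typed G (N(p := P)) \<and> plays G - {p} = plays_net N - {p}) \<Longrightarrow>
    typed (GIn q p Gs) N"


subsection \<open>Boundedness\<close>

text \<open>Paths are finite or infinite sequences of communications.\<close>

codatatype 'a path = Stop | Step 'a "'a path"

text \<open>Positions in a path are counted from 0; \<open>path_at \<xi> n\<close> is \<open>None\<close> beyond the end of \<open>\<xi>\<close>.\<close>

primrec path_at :: "'a path \<Rightarrow> nat \<Rightarrow> 'a option" where
  "path_at \<xi> 0 = (case \<xi> of Stop \<Rightarrow> None | Step a \<xi>' \<Rightarrow> Some a)"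
| "path_at \<xi> (Suc n) = (case \<xi> of Stop \<Rightarrow> None | Step a \<xi>' \<Rightarrow> path_at \<xi>' n)"

coinductive is_path :: "('p, 'l) gtype \<Rightarrow> ('p, 'l) comm path \<Rightarrow> bool" where
  is_path_End: "is_path End Stop"
| is_path_GOut: "fmlookup Gs l = Some G \<Longrightarrow> is_path G \<xi> \<Longrightarrow>
    is_path (GOut p q Gs) (Step (OutC p q l) \<xi>)"
| is_path_GIn: "fmlookup Gs l = Some G \<Longrightarrow> is_path G \<xi> \<Longrightarrow>
    is_path (GIn p q Gs) (Step (InC p q l) \<xi>)"

definition path_depth :: "('p, 'l) comm path \<Rightarrow> 'p \<Rightarrow> enat" where
  "path_depth \<xi> p = Inf {enat n | n. \<exists>\<beta>. path_at \<xi> n = Some \<beta> \<and> play \<beta> = p}"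

definition depth :: "('p, 'l) gtype \<Rightarrow> 'p \<Rightarrow> enat" where
  "depth G p = (if p \<in> plays G then 1 + Sup {path_depth \<xi> p | \<xi>. is_path G \<xi>} else 0)"

definition bounded_gtype :: "('p, 'l) gtype \<Rightarrow> bool" where
  "bounded_gtype G \<longleftrightarrow> (\<forall>G'. subtype G G' \<longrightarrow> (\<forall>p\<in>plays G'. depth G' p < \<infinity>))"


subsection \<open>Readability and balancing\<close>

inductive readable :: "('p, 'l) gtype \<Rightarrow> ('p, 'l) queue \<Rightarrow> bool" where
  readable_empty: "readable G empty_queue"
| readable_Out: "(\<forall>l G. fmlookup Gs l = Some G \<longrightarrow> readable G M) \<Longrightarrow>
    readable (GOut p q Gs) M"
| readable_In: "h |\<in>| fmdom Gs \<Longrightarrow>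
    (\<forall>l G. fmlookup Gs l = Some G \<longrightarrow> readable G M) \<Longrightarrow>
    readable (GIn p q Gs) (queue_cons (p, h, q) M)"
| readable_In_skip: "(\<forall>l M'. l |\<in>| fmdom Gs \<longrightarrow> M \<noteq> queue_cons (p, l, q) M') \<Longrightarrow>
    (\<forall>l G. fmlookup Gs l = Some G \<longrightarrow> readable G M) \<Longrightarrow>
    readable (GIn p q Gs) M"

coinductive balanced :: "('p, 'l) gtype \<Rightarrow> ('p, 'l) queue \<Rightarrow> bool" where
  balanced_End: "balanced End empty_queue"
| balanced_Out: "readable (GOut p q Gs) M \<Longrightarrow>
    (\<forall>l G. fmlookup Gs l = Some G \<longrightarrow> balanced G (enqueue M (p, l, q))) \<Longrightarrow>
    balanced (GOut p q Gs) M"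
| balanced_In: "readable (GIn p q Gs) (queue_cons (p, h, q) M) \<Longrightarrow>
    fmlookup Gs h = Some G \<Longrightarrow> balanced G M \<Longrightarrow>
    balanced (GIn p q Gs) (queue_cons (p, h, q) M)"

end

theory Submission
  imports Defs
begin

text \<open>No subject reduction for global types is needed.  A set of sessions is called persistent if in
  each of its members every active player is bound to move, and every message at the head of its
  channel is bound to be read, along a well-founded tree of sessions of the set in which each node
  branches over all moves of one enabled player.  The sessions typed by a bounded and balanced type
  form a persistent set: the global type itself is the tree, boundedness makes it well founded for
  the players, readability for the messages.  Since steps of different players commute, persistence
  survives closure under arbitrary steps.  A maximal coherent set moves every enabled player, in
  particular the one at the root of the tree, so lockstep computations descend in the tree until the
  required communication occurs.\<close>

section \<open>Queues as families of channels\<close>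

text \<open>Messages may be swapped unless they share both sender and receiver, so a queue modulo
  congruence amounts to a family of first-in first-out label lists, one for each ordered pair of
  participants.\<close>

lift_definition chan :: "('p, 'l) queue \<Rightarrow> 'p \<Rightarrow> 'p \<Rightarrow> 'l list"
  is "\<lambda>ms p q. map (\<lambda>m. fst (snd m)) (filter (\<lambda>m. fst m = p \<and> snd (snd m) = q) ms)"
proof -
  fix ms ms' :: "('p, 'l) message list"
  assume "queue_cong ms ms'"
  then show "(\<lambda>p q. map (\<lambda>m. fst (snd m)) (filter (\<lambda>m. fst m = p \<and> snd (snd m) = q) ms)) =
    (\<lambda>p q. map (\<lambda>m. fst (snd m)) (filter (\<lambda>m. fst m = p \<and> snd (snd m) = q) ms'))"
    by induction (auto simp: fun_eq_iff)
qed

lemma chan_empty_queue [simp]: "chan empty_queue p q = []"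
  by transfer simp

lemma chan_enqueue [simp]:
  "chan (enqueue M (p, l, q)) p' q' = chan M p' q' @ (if p' = p \<and> q' = q then [l] else [])"
  by transfer auto

lemma chan_queue_cons [simp]:
  "chan (queue_cons (p, l, q) M) p' q' = (if p' = p \<and> q' = q then [l] else []) @ chan M p' q'"
  by transfer auto

lemma queue_cong_move_front:
  assumes "\<forall>m\<in>set ms. fst m \<noteq> p \<or> snd (snd m) \<noteq> q"
  shows "queue_cong (ms @ (p, l, q) # ns) ((p, l, q) # ms @ ns)"
  using assms
proof (induction ms)
  case (Cons m ms)
  obtain a l' b where m: "m = (a, l', b)"
    by (cases m)
  have "queue_cong ([m] @ ms @ (p, l, q) # ns) ([m] @ (p, l, q) # ms @ ns)"
    by (rule queue_cong_append_left) (use Cons in auto)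
  moreover have "queue_cong ([] @ [(a, l', b), (p, l, q)] @ ms @ ns) ([] @ [(p, l, q), (a, l', b)] @ ms @ ns)"
    by (rule queue_cong_swap) (use Cons m in auto)
  ultimately show ?case
    using m by (auto intro: queue_cong_trans)
qed (simp add: queue_cong_refl)

lemma chan_eq_Cons_imp_queue_cons:
  assumes "chan M p q = l # ls"
  obtains M' where "M = queue_cons (p, l, q) M'"
proof -
  have "\<exists>M'. M = queue_cons (p, l, q) M'"
    using assms
  proof transfer
    fix ms :: "('p, 'l) message list" and p q l ls
    assume "map (\<lambda>m. fst (snd m)) (filter (\<lambda>m. fst m = p \<and> snd (snd m) = q) ms) = l # ls"
    then obtain m rest where "filter (\<lambda>m. fst m = p \<and> snd (snd m) = q) ms = m # rest" "fst (snd m) = l"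
      by auto
    then obtain us vs where "ms = us @ m # vs" "\<forall>u\<in>set us. \<not> (fst u = p \<and> snd (snd u) = q)"
      "fst m = p \<and> snd (snd m) = q"
      unfolding filter_eq_Cons_iff by blast
    moreover from this \<open>fst (snd m) = l\<close> have "m = (p, l, q)"
      by (cases m) auto
    ultimately show "\<exists>M'. queue_cong ms ([(p, l, q)] @ M')"
      using queue_cong_move_front[of us p q l vs] by auto
  qed
  then show ?thesis
    using that by blast
qed

lemma queue_cases:
  obtains "M = empty_queue" | p l q M' where "M = queue_cons (p, l, q) M'"
proof -
  have "M = empty_queue \<or> (\<exists>p l q M'. M = queue_cons (p, l, q) M')"
  proof transfer
    fix ms :: "('a, 'b) message list"
    show "queue_cong ms [] \<or> (\<exists>p l q M'. queue_cong ms ([(p, l, q)] @ M'))"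
    proof (cases ms)
      case Nil
      then show ?thesis
        by (simp add: queue_cong_refl)
    next
      case (Cons m ms')
      then have "queue_cong ms ([(fst m, fst (snd m), snd (snd m))] @ ms')"
        by (simp add: queue_cong_refl)
      then show ?thesis
        by blast
    qed
  qed
  then show ?thesis
    using that by blast
qed

lemma queue_induct [case_names empty cons]:
  assumes "P empty_queue" "\<And>p l q M. P M \<Longrightarrow> P (queue_cons (p, l, q) M)"
  shows "P M"
proof -
  have "P (abs_queue ms)" for ms
  proof (induction ms)
    case Nil
    then show ?case
      using assms(1) by (simp add: empty_queue_def)
  next
    case (Cons m ms)
    then show ?case
      using assms(2)[of "abs_queue ms" "fst m" "fst (snd m)" "snd (snd m)"]
      by (simp add: queue_cons.abs_eq)
  qed
  then show ?thesis
    using queue.abs_induct[of P M] by blast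
qed

text \<open>Induction on \<open>M\<close>: its front message is the head of a channel, hence also
  the head of that channel in \<open>M'\<close>, so it can be brought to the front of
  \<open>M'\<close> and cancelled on both sides.\<close>

lemma queue_eqI:
  assumes "\<And>p q. chan M p q = chan M' p q"
  shows "M = M'"
  using assms
proof (induction M arbitrary: M' rule: queue_induct)
  case empty
  show ?case
  proof (cases M' rule: queue_cases)
    case (2 p l q M'')
    then show ?thesis
      using empty[of p q] by simp
  qed simp
next
  case (cons p l q M)
  have "chan M' p q = l # chan M p q"
    using cons.prems[of p q] by simp
  then obtain M'' where M'': "M' = queue_cons (p, l, q) M''"
    by (rule chan_eq_Cons_imp_queue_cons)
  have "chan M p' q' = chan M'' p' q'" for p' q'
    using cons.prems[of p' q'] M'' by (auto split: if_splits)
  then show ?case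
    using cons.IH M'' by blast
qed

lemma queue_cons_eq_iff:
  "queue_cons (p, l, q) M = queue_cons (p, l', q) M' \<longleftrightarrow> l = l' \<and> M = M'"
proof
  assume eq: "queue_cons (p, l, q) M = queue_cons (p, l', q) M'"
  then have ch: "chan (queue_cons (p, l, q) M) a b = chan (queue_cons (p, l', q) M') a b" for a b
    by simp
  have "l = l'"
    using ch[of p q] by simp
  moreover have "chan M a b = chan M' a b" for a b
    using ch[of a b] by (auto split: if_splits)
  ultimately show "l = l' \<and> M = M'"
    using queue_eqI by blast
qed simp

lemma queue_cons_eq_cross:
  assumes "queue_cons (p, l, q) M = queue_cons (p', l', q') M'" "q \<noteq> q'"
  obtains K where "M = queue_cons (p', l', q') K" "M' = queue_cons (p, l, q) K"
proof -
  have ch: "chan (queue_cons (p, l, q) M) a b = chan (queue_cons (p', l', q') M') a b" for a b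
    using assms(1) by simp
  have "chan M p' q' = l' # chan M' p' q'"
    using ch[of p' q'] assms(2) by simp
  then obtain K where K: "M = queue_cons (p', l', q') K"
    by (rule chan_eq_Cons_imp_queue_cons)
  have "M' = queue_cons (p, l, q) K"
  proof (rule queue_eqI)
    fix a b
    show "chan M' a b = chan (queue_cons (p, l, q) K) a b"
      using ch[of a b] K assms(2) by (auto split: if_splits)
  qed
  with K show ?thesis
    using that by blast
qed

lemma enqueue_queue_cons: "enqueue (queue_cons m M) m' = queue_cons m (enqueue M m')"
  by transfer (auto intro: queue_cong_refl)

lemma enqueue_commute:
  "p \<noteq> p' \<Longrightarrow> enqueue (enqueue M (p, l, q)) (p', l', q') = enqueue (enqueue M (p', l', q')) (p, l, q)"
  by (rule queue_eqI) auto


section \<open>Steps of different players commute\<close>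

lemma session_step_OutC_iff:
  "session_step (N, M) (OutC p q l) S' \<longleftrightarrow>
    (\<exists>Ps P. N p = Send q Ps \<and> fmlookup Ps l = Some P \<and> S' = (N(p := P), enqueue M (p, l, q)))"
  by (auto elim: session_step.cases intro: step_out)

lemma session_step_InC_iff:
  "session_step (N, M) (InC p q l) S' \<longleftrightarrow>
    (\<exists>Qs Q M'. N q = Recv p Qs \<and> fmlookup Qs l = Some Q \<and> M = queue_cons (p, l, q) M' \<and>
      S' = (N(q := Q), M'))"
  by (auto elim: session_step.cases intro: step_in)

lemmas session_step_iffs = session_step_OutC_iff session_step_InC_iff

lemma session_step_deterministic:
  "session_step S \<beta> S1 \<Longrightarrow> session_step S \<beta> S2 \<Longrightarrow> S1 = S2"
  by (cases S; cases \<beta>) (auto simp: session_step_iffs queue_cons_eq_iff)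

lemma session_step_other_process:
  "session_step S \<beta> S' \<Longrightarrow> play \<beta> \<noteq> p \<Longrightarrow> fst S' p = fst S p"
  by (cases S; cases \<beta>) (auto simp: session_step_iffs)

text \<open>Different players change different components. On the queue, two outputs write to
  different channels, two inputs read from different ones, and an output appends behind the head
  that an input removes.\<close>

lemma session_step_diamond:
  assumes "session_step S \<beta> S1" "session_step S \<gamma> S2" "play \<beta> \<noteq> play \<gamma>"
  obtains S3 where "session_step S1 \<gamma> S3" "session_step S2 \<beta> S3"
proof -
  obtain N M where S: "S = (N, M)"
    by (cases S)
  have out_in: "\<exists>S3. session_step S1 \<gamma> S3 \<and> session_step S2 \<beta> S3"
    if steps: "session_step (N, M) \<beta> S1" "session_step (N, M) \<gamma> S2" "play \<beta> \<noteq> play \<gamma>"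
      "\<beta> = OutC p q l" "\<gamma> = InC p' q' l'" for \<beta> \<gamma> p q l p' q' l' S1 S2
  proof -
    obtain Ps P where *:
      "N p = Send q Ps" "fmlookup Ps l = Some P" "S1 = (N(p := P), enqueue M (p, l, q))"
      using steps(1,4) by (auto simp: session_step_iffs)
    obtain Qs Q K where **:
      "N q' = Recv p' Qs" "fmlookup Qs l' = Some Q" "M = queue_cons (p', l', q') K"
      "S2 = (N(q' := Q), K)"
      using steps(2,5) by (auto simp: session_step_iffs)
    have "p \<noteq> q'"
      using steps by simp
    then have "session_step S1 \<gamma> (N(p := P, q' := Q), enqueue K (p, l, q))"
      "session_step S2 \<beta> (N(q' := Q, p := P), enqueue K (p, l, q))"
      using * ** steps(4,5) by (auto simp: session_step_iffs enqueue_queue_cons)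
    then show ?thesis
      using \<open>p \<noteq> q'\<close> by (metis fun_upd_twist)
  qed
  have "\<exists>S3. session_step S1 \<gamma> S3 \<and> session_step S2 \<beta> S3"
  proof (cases \<beta>)
    case \<beta>: (OutC p q l)
    show ?thesis
    proof (cases \<gamma>)
      case (OutC p' q' l')
      obtain Ps P Qs Q where *:
        "N p = Send q Ps" "fmlookup Ps l = Some P" "S1 = (N(p := P), enqueue M (p, l, q))"
        "N p' = Send q' Qs" "fmlookup Qs l' = Some Q" "S2 = (N(p' := Q), enqueue M (p', l', q'))"
        using assms \<beta> OutC S by (auto simp: session_step_iffs)
      have "p \<noteq> p'"
        using assms \<beta> OutC by simp
      then have "session_step S1 \<gamma> (N(p := P, p' := Q), enqueue (enqueue M (p, l, q)) (p', l', q'))"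
        "session_step S2 \<beta> (N(p' := Q, p := P), enqueue (enqueue M (p', l', q')) (p, l, q))"
        using * \<beta> OutC by (auto simp: session_step_iffs)
      then show ?thesis
        using \<open>p \<noteq> p'\<close> by (metis fun_upd_twist enqueue_commute)
    next
      case (InC p' q' l')
      then show ?thesis
        using out_in assms \<beta> S by blast
    qed
  next
    case \<beta>: (InC p q l)
    show ?thesis
    proof (cases \<gamma>)
      case (OutC p' q' l')
      then show ?thesis
        using out_in[OF _ _ _ OutC \<beta>, of S2 S1] assms S by fastforce
    next
      case (InC p' q' l')
      obtain Qs Q M1 Qs' Q' M2 where *:
        "N q = Recv p Qs" "fmlookup Qs l = Some Q" "M = queue_cons (p, l, q) M1" "S1 = (N(q := Q), M1)"
        "N q' = Recv p' Qs'" "fmlookup Qs' l' = Some Q'" "M = queue_cons (p', l', q') M2"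
        "S2 = (N(q' := Q'), M2)"
        using assms \<beta> InC S by (auto simp: session_step_iffs)
      have ne: "q \<noteq> q'"
        using assms \<beta> InC by simp
      obtain K where K: "M1 = queue_cons (p', l', q') K" "M2 = queue_cons (p, l, q) K"
        using queue_cons_eq_cross[of p l q M1 p' l' q' M2] *(3,7) ne by metis
      then have "session_step S1 \<gamma> (N(q := Q, q' := Q'), K)"
        "session_step S2 \<beta> (N(q' := Q', q := Q), K)"
        using *(1,2,4,5,6,8) \<beta> InC ne by (auto simp: session_step_iffs queue_cons_eq_iff)
      then show ?thesis
        using ne by (metis fun_upd_twist)
    qed
  qed
  then show ?thesis
    using that by blast
qed

section \<open>Enabled players and moving their communications to the front\<close>

definition enabled :: "'p \<Rightarrow> ('p, 'l) session \<Rightarrow> bool" where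
  "enabled p S \<longleftrightarrow> (\<exists>\<beta> S'. play \<beta> = p \<and> session_step S \<beta> S')"

lemma enabledI: "session_step S \<beta> S' \<Longrightarrow> enabled (play \<beta>) S"
  unfolding enabled_def by blast

lemma enabled_preserved:
  "enabled p S \<Longrightarrow> session_step S \<beta> S' \<Longrightarrow> play \<beta> \<noteq> p \<Longrightarrow> enabled p S'"
  unfolding enabled_def by (metis session_step_diamond)

text \<open>In general \<gamma> could read a message that \<beta> has just sent. This is excluded
  because the player of \<gamma> can already move in \<open>S\<close>: if it waits for input, the
  channel it reads is nonempty there, and \<beta> can only append behind its head.\<close>

lemma session_step_commute:
  assumes "enabled (play \<gamma>) S" "session_step S \<beta> S1" "session_step S1 \<gamma> S2" "play \<beta> \<noteq> play \<gamma>"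
  obtains T where "session_step S \<gamma> T" "session_step T \<beta> S2"
proof -
  obtain N M where S: "S = (N, M)"
    by (cases S)
  obtain N1 M1 where S1: "S1 = (N1, M1)"
    by (cases S1)
  have same: "N1 (play \<gamma>) = N (play \<gamma>)"
    using session_step_other_process[OF assms(2,4)] S S1 by simp
  obtain \<gamma>' T where g': "play \<gamma>' = play \<gamma>" "session_step S \<gamma>' T"
    using assms(1) unfolding enabled_def by blast
  obtain S3 where S3: "session_step S1 \<gamma>' S3"
    using session_step_diamond[OF assms(2) g'(2)] assms(4) g'(1) by metis
  have "\<exists>T. session_step S \<gamma> T"
  proof (cases \<gamma>)
    case (OutC p q l)
    then show ?thesis
      using same assms(3) S S1 by (auto simp: session_step_iffs)
  next
    case (InC p q l)
    \<comment> \<open>After \<beta> both inputs are possible for the same process, so they read the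
      head of the same channel and carry the same label.\<close>
    then have "\<gamma>' = \<gamma>"
      using same assms(3) S S1 S3 g'
      by (cases \<gamma>') (auto simp: session_step_iffs queue_cons_eq_iff)
    then show ?thesis
      using g' by blast
  qed
  then obtain T where T: "session_step S \<gamma> T"
    by blast
  then obtain S3 where "session_step S1 \<gamma> S3" "session_step T \<beta> S3"
    using session_step_diamond assms(2,4) by metis
  with T show ?thesis
    using session_step_deterministic[OF assms(3)] that by metis
qed

text \<open>The first move of \<open>p\<close> is swapped leftwards past the moves of the others;
  \<open>p\<close> stays enabled until it moves, so every swap is legitimate. The inclusion of sets
  lets a sequence that avoids given communications keep avoiding them.\<close>

lemma trans_seq_commute_front:
  assumes "trans_seq S \<beta>s S'" "enabled p S" "\<exists>\<beta>\<in>set \<beta>s. play \<beta> = p"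
  shows "\<exists>\<beta>\<in>set \<beta>s. \<exists>T \<beta>s'. play \<beta> = p \<and> session_step S \<beta> T \<and> trans_seq T \<beta>s' S' \<and> set \<beta>s' \<subseteq> set \<beta>s"
  using assms
proof (induction rule: trans_seq.induct)
  case (trans_seq_Cons S \<beta> S1 \<beta>s S')
  show ?case
  proof (cases "play \<beta> = p")
    case True
    have "\<beta> \<in> set (\<beta> # \<beta>s)" "set \<beta>s \<subseteq> set (\<beta> # \<beta>s)"
      by auto
    then show ?thesis
      using trans_seq_Cons.hyps True by blast
  next
    case False
    then have "enabled p S1"
      using trans_seq_Cons enabled_preserved by metis
    then obtain \<gamma> T \<gamma>s where g: "\<gamma> \<in> set \<beta>s" "play \<gamma> = p" "session_step S1 \<gamma> T"
      "trans_seq T \<gamma>s S'" "set \<gamma>s \<subseteq> set \<beta>s"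
      using trans_seq_Cons False by auto
    then obtain U where U: "session_step S \<gamma> U" "session_step U \<beta> T"
      using session_step_commute[of \<gamma> S \<beta> S1 T] trans_seq_Cons False by metis
    then have "trans_seq U (\<beta> # \<gamma>s) S'"
      using g trans_seq.trans_seq_Cons by blast
    moreover have "\<gamma> \<in> set (\<beta> # \<beta>s)" "set (\<beta> # \<gamma>s) \<subseteq> set (\<beta> # \<beta>s)"
      using g by auto
    ultimately show ?thesis
      using g U by blast
  qed
qed simp

lemma trans_seq_enabled:
  "trans_seq S \<beta>s S' \<Longrightarrow> enabled p S \<Longrightarrow> \<forall>\<beta>\<in>set \<beta>s. play \<beta> \<noteq> p \<Longrightarrow> enabled p S'"
  by (induction rule: trans_seq.induct) (auto dest: enabled_preserved)

lemma trans_seq_append: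
  "trans_seq S \<beta>s S' \<Longrightarrow> trans_seq S' \<gamma>s S'' \<Longrightarrow> trans_seq S (\<beta>s @ \<gamma>s) S''"
  by (induction rule: trans_seq.induct) (auto intro: trans_seq.intros)

lemma trans_seq_other_process:
  "trans_seq S \<beta>s S' \<Longrightarrow> \<forall>\<beta>\<in>set \<beta>s. play \<beta> \<noteq> p \<Longrightarrow> fst S' p = fst S p"
  by (induction rule: trans_seq.induct) (auto simp: session_step_other_process)


section \<open>Inevitable communications\<close>

text \<open>Membership in \<open>X\<close> is demanded also after a move in \<open>B\<close>, where
  the tree ends: this allows a new tree to be started at that point. Enabledness at each node
  excludes vacuous branching.\<close>

inductive inevitable ::
  "('p, 'l) session set \<Rightarrow> ('p, 'l) comm set \<Rightarrow> ('p, 'l) session \<Rightarrow> bool" for X B where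
  inevitableI: "enabled p S \<Longrightarrow>
    (\<And>\<beta> S'. play \<beta> = p \<Longrightarrow> session_step S \<beta> S' \<Longrightarrow> S' \<in> X \<and> (\<beta> \<in> B \<or> inevitable X B S')) \<Longrightarrow>
    inevitable X B S"

lemma inevitable_mono:
  assumes "inevitable X B S" "X \<subseteq> Y"
  shows "inevitable Y B S"
  using assms(1)
proof induction
  case (inevitableI p S)
  show ?case
    by (rule inevitable.inevitableI[OF inevitableI.hyps(1)]) (use inevitableI.IH assms(2) in blast)
qed

text \<open>The two obligations behind progress: an active player owes some move, whichever it is,
  and a message at the head of its channel is owed its reading.\<close>

inductive pending :: "('p, 'l) session \<Rightarrow> ('p, 'l) comm set \<Rightarrow> bool" where
  pending_player: "N p \<noteq> Inact \<Longrightarrow> pending (N, M) {\<beta>. play \<beta> = p}"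
| pending_message: "pending (N, queue_cons (p, l, q) M) {InC p q l}"

text \<open>A player that does not move keeps its process. A channel head is displaced neither by
  outputs, which append, nor by inputs from other channels; an input from its own channel can only
  read it and thus lies in \<open>B\<close>.\<close>

lemma pending_preserved:
  assumes "pending S B" "session_step S \<beta> S'" "\<beta> \<notin> B"
  shows "pending S' B"
  using assms(1)
proof cases
  case (pending_player N p M)
  then show ?thesis
    using assms session_step_other_process[of S \<beta> S' p] pending.pending_player[of "fst S'" p "snd S'"]
    by simp
next
  case (pending_message N p l q M)
  obtain N' M' where S': "S' = (N', M')"
    by (cases S')
  have "\<exists>ls. chan M' p q = l # ls"
  proof (cases \<beta>)
    case (OutC p' q' l')
    then show ?thesis
      using assms pending_message S' by (auto simp: session_step_iffs)
  next
    case (InC p' q' l')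
    then have eq: "queue_cons (p, l, q) M = queue_cons (p', l', q') M'"
      using assms pending_message S' by (auto simp: session_step_iffs)
    then have ne: "\<not> (p' = p \<and> q' = q)"
      using assms(3) InC pending_message by (auto simp: queue_cons_eq_iff)
    have "chan (queue_cons (p', l', q') M') p q = l # chan M p q"
      using eq[symmetric] by simp
    then show ?thesis
      using ne by (auto split: if_splits)
  qed
  then show ?thesis
    using chan_eq_Cons_imp_queue_cons S' pending_message(2) pending.pending_message by metis
qed

text \<open>Closure is asked only along the trees, where a single player moves at each node, so that
  sessions following their global types in order can be shown to form such a set.\<close>

definition persistent :: "('p, 'l) session set \<Rightarrow> bool" where
  "persistent X \<longleftrightarrow> (\<forall>S\<in>X. \<forall>B. pending S B \<longrightarrow> inevitable X B S)"

text \<open>A communication pending after \<open>\<beta>\<close> need not be pending before it.  The induction therefore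
  follows the tree in which the player of \<open>\<beta>\<close> moves, up to the point where that move puts the session
  back into \<open>X\<close>.\<close>

lemma inevitable_after_step:
  assumes "persistent X" "inevitable X {\<gamma>. play \<gamma> = play \<beta>} S" "session_step S \<beta> S'" "pending S' B"
  shows "inevitable {T. T \<in> X \<or> (\<exists>S\<in>X. \<exists>\<beta>. session_step S \<beta> T)} B S'"
    (is "inevitable ?Y B S'")
  using assms(2-)
proof (induction arbitrary: S')
  case (inevitableI p S)
  show ?case
  proof (cases "play \<beta> = p")
    case True
    then have "S' \<in> X"
      using inevitableI by blast
    then have "inevitable X B S'"
      using assms(1) inevitableI.prems unfolding persistent_def by blast
    then show ?thesis
      by (rule inevitable_mono) blast
  next
    case False
    show ?thesis
    proof (rule inevitable.inevitableI)
      show "enabled p S'"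
        using enabled_preserved inevitableI False by metis
    next
      fix \<gamma> S''
      assume g: "play \<gamma> = p" "session_step S' \<gamma> S''"
      then obtain T where T: "session_step S \<gamma> T" "session_step T \<beta> S''"
        using session_step_commute[of \<gamma> S \<beta> S' S''] inevitableI False by metis
      then have "S'' \<in> ?Y"
        using inevitableI.IH g by blast
      moreover have "inevitable ?Y B S''" if "\<gamma> \<notin> B"
      proof -
        have "\<gamma> \<notin> {\<gamma>. play \<gamma> = play \<beta>}"
          using g(1) False by simp
        then show ?thesis
          using inevitableI.IH[OF g(1) T(1)] T(2) pending_preserved[OF inevitableI.prems(2) g(2) that]
          by blast
      qed
      ultimately show "S'' \<in> ?Y \<and> (\<gamma> \<in> B \<or> inevitable ?Y B S'')"
        by blast
    qed
  qed
qed

lemma session_step_active: "session_step S \<beta> S' \<Longrightarrow> fst S (play \<beta>) \<noteq> Inact"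
  by (cases S; cases \<beta>) (auto simp: session_step_iffs)

text \<open>For a successor of \<open>S\<close> under \<beta>, the player of \<beta> was active in
  \<open>S\<close>; persistence applied to this obligation yields the tree whose moves are commuted
  with \<beta>.\<close>

lemma persistent_step_closure:
  assumes "persistent X"
  shows "persistent {T. T \<in> X \<or> (\<exists>S\<in>X. \<exists>\<beta>. session_step S \<beta> T)}" (is "persistent ?Y")
  unfolding persistent_def
proof (intro ballI allI impI)
  fix T B
  assume T: "T \<in> ?Y" "pending T B"
  show "inevitable ?Y B T"
  proof (cases "T \<in> X")
    case True
    then have "inevitable X B T"
      using assms T unfolding persistent_def by blast
    then show ?thesis
      by (rule inevitable_mono) blast
  next
    case False
    then obtain S \<beta> where S: "S \<in> X" "session_step S \<beta> T"
      using T by blast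
    then have "pending S {\<gamma>. play \<gamma> = play \<beta>}"
      using session_step_active[OF S(2)] pending_player by (cases S) auto
    then have "inevitable X {\<gamma>. play \<gamma> = play \<beta>} S"
      using assms S unfolding persistent_def by blast
    then show ?thesis
      using inevitable_after_step assms S T by blast
  qed
qed

definition live :: "('p, 'l) session \<Rightarrow> bool" where
  "live S \<longleftrightarrow> (\<exists>X. persistent X \<and> S \<in> X)"

lemma live_step: "live S \<Longrightarrow> session_step S \<beta> S' \<Longrightarrow> live S'"
  unfolding live_def using persistent_step_closure by blast

lemma live_trans_seq: "trans_seq S \<beta>s S' \<Longrightarrow> live S \<Longrightarrow> live S'"
  by (induction rule: trans_seq.induct) (auto intro: live_step)

lemma live_lockstep_derivative:
  assumes "lockstep_derivative S S'" "live S"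
  shows "live S'"
  using assms unfolding lockstep_derivative_def
  by (induction rule: rtranclp_induct) (auto simp: lockstep_def intro: live_trans_seq)

lemma live_pending_inevitable:
  assumes "live S" "pending S B"
  obtains X where "inevitable X B S"
  using assms unfolding live_def persistent_def by blast

text \<open>Outside termination some obligation is pending, from a queue head or, if the queue is
  empty, from an active player; the root of its tree supplies an enabled player.\<close>

lemma live_not_deadlocked:
  assumes "live S"
  shows "\<not> deadlocked S"
proof (cases "terminated S")
  case False
  obtain N M where S: "S = (N, M)"
    by (cases S)
  have "\<exists>B. pending S B"
  proof (cases M rule: queue_cases)
    case 1
    then obtain p where "N p \<noteq> Inact"
      using False S by (auto simp: terminated_def)
    then show ?thesis
      using S pending_player[of N p M] by blast
  next
    case (2 p l q M')
    then show ?thesis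
      using S pending_message[of N p l q M'] by blast
  qed
  then obtain X B where "inevitable X B S"
    using live_pending_inevitable[OF assms] by blast
  then have "\<exists>p. enabled p S"
    by cases blast
  then show ?thesis
    unfolding deadlocked_def no_transition_def enabled_def by blast
qed (simp add: deadlocked_def)


section \<open>Lockstep computations perform inevitable communications\<close>

lemma max_coherent_enabled:
  assumes "max_coherent S \<Delta>" "enabled p S"
  obtains \<beta> where "\<beta> \<in> \<Delta>" "play \<beta> = p"
proof -
  have "\<exists>\<beta>\<in>\<Delta>. play \<beta> = p"
  proof (rule ccontr)
    assume none: "\<not> (\<exists>\<beta>\<in>\<Delta>. play \<beta> = p)"
    obtain \<gamma> where g: "play \<gamma> = p" "\<exists>S'. session_step S \<gamma> S'"
      using assms(2) unfolding enabled_def by blast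
    have "coherent S (insert \<gamma> \<Delta>)"
      using assms(1) none g unfolding max_coherent_def coherent_def by (auto simp: inj_on_def)
    then have "insert \<gamma> \<Delta> = \<Delta>"
      using assms(1) unfolding max_coherent_def by blast
    then show False
      using none g by blast
  qed
  then show ?thesis
    using that by blast
qed

lemma complete_lockstep_enabled:
  assumes "complete_lockstep S \<sigma> \<delta> n" "enabled p S"
  shows "0 < n"
proof -
  have "n \<noteq> enat 0"
    using assms unfolding complete_lockstep_def no_transition_def enabled_def by blast
  then show ?thesis
    by (simp add: flip: zero_enat_def)
qed

lemma complete_lockstep_tail:
  assumes "complete_lockstep S \<sigma> \<delta> n" "0 < n"
  shows "complete_lockstep (\<sigma> 1) (\<lambda>h. \<sigma> (Suc h)) (\<lambda>h. \<delta> (Suc h)) (n - 1)"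
proof (cases n)
  case (enat k)
  then obtain m where "k = Suc m"
    using assms(2) by (cases k) (auto simp: zero_enat_def)
  then show ?thesis
    using assms enat unfolding complete_lockstep_def by (auto simp: one_enat_def)
next
  case infinity
  then show ?thesis
    using assms unfolding complete_lockstep_def by simp
qed

text \<open>A lockstep step may perform more than the root's move, so the computation runs ahead of
  the tree: \<open>\<beta>s\<close> records the moves, all outside \<open>B\<close>, that lead from
  the node \<open>S\<close> to the current session \<open>S'\<close>. If the root's player occurs in
  it, its first move is commuted to the front and the induction descends. Otherwise that player is
  still enabled, and by maximality the next step contains a move of it.\<close>

lemma inevitable_hit:
  assumes "inevitable X B S" "trans_seq S \<beta>s S'" "set \<beta>s \<inter> B = {}" "complete_lockstep S' \<sigma> \<delta> n"
  shows "\<exists>h \<beta>. enat h < n \<and> \<beta> \<in> \<delta> h \<and> \<beta> \<in> B"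
  using assms
proof (induction arbitrary: \<beta>s S' \<sigma> \<delta> n)
  case (inevitableI p S)
  have played: "\<exists>h \<beta>. enat h < n \<and> \<beta> \<in> \<delta> h \<and> \<beta> \<in> B"
    if *: "trans_seq S \<gamma>s U" "set \<gamma>s \<inter> B = {}" "complete_lockstep U \<sigma> \<delta> n" "\<exists>\<gamma>\<in>set \<gamma>s. play \<gamma> = p"
    for \<gamma>s U \<sigma> \<delta> n
  proof -
    obtain \<beta> T \<beta>s' where "\<beta> \<in> set \<gamma>s" "play \<beta> = p" "session_step S \<beta> T" "trans_seq T \<beta>s' U"
      "set \<beta>s' \<subseteq> set \<gamma>s"
      using trans_seq_commute_front[OF *(1) inevitableI.hyps *(4)] by blast
    then show ?thesis
      using inevitableI.IH *(2,3) by blast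
  qed
  show ?case
  proof (cases "\<exists>\<gamma>\<in>set \<beta>s. play \<gamma> = p")
    case True
    then show ?thesis
      using played inevitableI.prems by blast
  next
    case False
    then have en: "enabled p S'"
      using trans_seq_enabled inevitableI by metis
    then have n: "0 < n"
      using complete_lockstep_enabled[OF inevitableI.prems(3)] by blast
    then have "lockstep S' (\<delta> 0) (\<sigma> 1)"
      using inevitableI.prems(3) unfolding complete_lockstep_def by (auto simp: zero_enat_def)
    then obtain \<gamma>s where g: "set \<gamma>s = \<delta> 0" "trans_seq S' \<gamma>s (\<sigma> 1)" "max_coherent S' (\<delta> 0)"
      unfolding lockstep_def by blast
    show ?thesis
    proof (cases "\<delta> 0 \<inter> B = {}")
      case True
      obtain \<gamma> where "\<gamma> \<in> set \<gamma>s" "play \<gamma> = p"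
        using max_coherent_enabled g en by metis
      then have "\<exists>\<gamma>\<in>set (\<beta>s @ \<gamma>s). play \<gamma> = p" "set (\<beta>s @ \<gamma>s) \<inter> B = {}"
        using inevitableI.prems(2) True g(1) by auto
      then have "\<exists>h \<beta>. enat h < n - 1 \<and> \<beta> \<in> \<delta> (Suc h) \<and> \<beta> \<in> B"
        using played[OF trans_seq_append[OF inevitableI.prems(1) g(2)] _
            complete_lockstep_tail[OF inevitableI.prems(3) n]] by simp
      moreover have "enat (Suc h) < n" if "enat h < n - 1" for h
        using that by (cases n) (auto simp: one_enat_def)
      ultimately show ?thesis
        by blast
    next
      case False
      then show ?thesis
        using n unfolding zero_enat_def by blast
    qed
  qed
qed

lemma live_hit:
  assumes "live S" "pending S B" "complete_lockstep S \<sigma> \<delta> n"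
  obtains h \<beta> where "enat h < n" "\<beta> \<in> \<delta> h" "\<beta> \<in> B"
proof -
  obtain X where "inevitable X B S"
    using live_pending_inevitable assms by blast
  then show ?thesis
    using inevitable_hit[OF _ trans_seq_Nil _ assms(3)] that by fastforce
qed

lemma live_queue_consuming:
  assumes "live S"
  shows "queue_consuming S"
  unfolding queue_consuming_def
proof (intro allI impI)
  fix p l q M' \<sigma> \<delta> n
  assume "snd S = queue_cons (p, l, q) M'" "complete_lockstep S \<sigma> \<delta> n"
  moreover from this have "pending S {InC p q l}"
    using pending_message by (cases S) auto
  ultimately show "\<exists>h. enat h < n \<and> InC p q l \<in> \<delta> h"
    using live_hit[OF assms] by (metis singletonD)
qed

text \<open>The pending player only guarantees some move of \<open>p\<close>. At the first step
  where \<open>p\<close> moves its process is still \<open>Recv q Ps\<close>, so the move must be an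
  input from \<open>q\<close> with a label of \<open>Ps\<close>.\<close>

lemma live_input_enabling:
  assumes "live S"
  shows "input_enabling S"
  unfolding input_enabling_def
proof (intro allI impI)
  fix p q Ps \<sigma> \<delta> n
  assume recv: "fst S p = Recv q Ps" and comp: "complete_lockstep S \<sigma> \<delta> n"
  define hit where "hit = (\<lambda>h. enat h < n \<and> (\<exists>\<beta>\<in>\<delta> h. play \<beta> = p))"
  have "pending S {\<beta>. play \<beta> = p}"
    using recv pending_player[of "fst S" p "snd S"] by simp
  then have "\<exists>h. hit h"
    unfolding hit_def using live_hit[OF assms _ comp] by blast
  then obtain h where h: "hit h" "\<And>k. k < h \<Longrightarrow> \<not> hit k"
    unfolding exists_least_iff[of hit] by blast
  have same: "fst (\<sigma> k) p = Recv q Ps" if "k \<le> h" for k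
    using that
  proof (induction k)
    case 0
    then show ?case
      using comp recv unfolding complete_lockstep_def by simp
  next
    case (Suc k)
    then have "enat k < n"
      using h(1) unfolding hit_def by (cases n) auto
    then have "\<forall>\<beta>\<in>\<delta> k. play \<beta> \<noteq> p" "lockstep (\<sigma> k) (\<delta> k) (\<sigma> (Suc k))"
      using h(2)[of k] Suc.prems comp unfolding hit_def complete_lockstep_def by auto
    then show ?case
      using trans_seq_other_process[of "\<sigma> k" _ "\<sigma> (Suc k)" p] Suc unfolding lockstep_def by auto
  qed
  obtain \<beta> where \<beta>: "enat h < n" "\<beta> \<in> \<delta> h" "play \<beta> = p"
    using h(1) unfolding hit_def by blast
  then have "lockstep (\<sigma> h) (\<delta> h) (\<sigma> (Suc h))"
    using comp unfolding complete_lockstep_def by blast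
  \<comment> \<open>Coherence makes \<beta> possible in \<open>\<sigma> h\<close> itself, before the
    other moves of the step.\<close>
  then obtain S' where "session_step (\<sigma> h) \<beta> S'"
    using \<beta>(2) unfolding lockstep_def max_coherent_def coherent_def by blast
  then obtain l where "\<beta> = InC q p l" "l |\<in>| fmdom Ps"
    using same[of h] \<beta>(3) by (cases "\<sigma> h"; cases \<beta>) (auto simp: session_step_iffs intro: fmdomI)
  then show "\<exists>h l. enat h < n \<and> l |\<in>| fmdom Ps \<and> InC q p l \<in> \<delta> h"
    using \<beta> by blast
qed

lemma live_progress: "live S \<Longrightarrow> progress S"
  unfolding progress_def
  by (metis live_input_enabling live_lockstep_derivative live_not_deadlocked live_queue_consuming)


section \<open>Typed, bounded and balanced sessions are live\<close>

lemma subtype_branch: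
  assumes "fmlookup (gbranches G) l = Some G'" "subtype G' H"
  shows "subtype G H"
  using assms(2) by induction (auto intro: subtype.intros assms(1))

text \<open>The invariant handed down from a type to its branches. Nonempty choices are stated for
  all subterms so as to be inherited; they provide a branch at each node, for enabledness as well as
  for paths.\<close>

definition sound_typing :: "('p, 'l) gtype \<Rightarrow> ('p, 'l) session \<Rightarrow> bool" where
  "sound_typing G S \<longleftrightarrow>
     (\<forall>H. subtype G H \<longrightarrow> H \<noteq> End \<longrightarrow> gbranches H \<noteq> fmempty) \<and>
     typed G (fst S) \<and> bounded_gtype G \<and> balanced G (snd S)"

lemma sound_typing_branch:
  assumes "sound_typing G S" "fmlookup (gbranches G) l = Some G'" "typed G' (fst S')" "balanced G' (snd S')"
  shows "sound_typing G' S'"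
  using assms subtype_branch[OF assms(2)] unfolding sound_typing_def bounded_gtype_def by blast

lemma sound_typing_nonempty:
  assumes "sound_typing G S" "G \<noteq> End"
  obtains l G' where "fmlookup (gbranches G) l = Some G'"
proof -
  have "gbranches G \<noteq> fmempty"
    using assms subtype_refl unfolding sound_typing_def by blast
  then have "\<exists>l G'. fmlookup (gbranches G) l = Some G'"
    by (metis fmap_ext fmempty_lookup not_None_eq)
  then show ?thesis
    using that by blast
qed

lemma sound_typing_End: "sound_typing End S \<Longrightarrow> S = ((\<lambda>_. Inact), empty_queue)"
  unfolding sound_typing_def by (cases S) (auto elim: typed.cases balanced.cases)

lemma sound_typing_GOut:
  assumes "sound_typing (GOut p q Gs) (N, M)"
  shows "enabled p (N, M)"
    and "play \<beta> = p \<Longrightarrow> session_step (N, M) \<beta> (N', M') \<Longrightarrow>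
      \<exists>l G. \<beta> = OutC p q l \<and> fmlookup Gs l = Some G \<and> sound_typing G (N', M') \<and> M' = enqueue M (p, l, q)"
proof -
  have "typed (GOut p q Gs) N" "balanced (GOut p q Gs) M"
    using assms unfolding sound_typing_def by auto
  then obtain Ps where Ps: "N p = Send q Ps" "fmdom Gs = fmdom Ps"
    and ty: "\<And>l G P. fmlookup Gs l = Some G \<Longrightarrow> fmlookup Ps l = Some P \<Longrightarrow> typed G (N(p := P))"
    and bal: "\<And>l G. fmlookup Gs l = Some G \<Longrightarrow> balanced G (enqueue M (p, l, q))"
    by (auto elim!: typed.cases[of "GOut p q Gs"] balanced.cases[of "GOut p q Gs"])
  obtain l G where "fmlookup Gs l = Some G"
    using sound_typing_nonempty[OF assms] by auto
  then obtain P where "fmlookup Ps l = Some P"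
    using Ps(2) by (metis fmdomI fmdomE)
  then show "enabled p (N, M)"
    using enabledI[OF step_out[of N p q Ps l P M]] Ps(1) by simp
  assume "play \<beta> = p" "session_step (N, M) \<beta> (N', M')"
  then obtain l P where b: "\<beta> = OutC p q l" "fmlookup Ps l = Some P" "N' = N(p := P)"
    "M' = enqueue M (p, l, q)"
    using Ps(1) by (cases \<beta>) (auto simp: session_step_iffs)
  then obtain G where G: "fmlookup Gs l = Some G"
    using Ps(2) by (metis fmdomI fmdomE)
  then have "sound_typing G (N', M')"
    using sound_typing_branch[OF assms, of l G "(N', M')"] ty[OF G b(2)] bal[OF G] b by simp
  then show "\<exists>l G. \<beta> = OutC p q l \<and> fmlookup Gs l = Some G \<and> sound_typing G (N', M') \<and>
      M' = enqueue M (p, l, q)"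
    using b G by blast
qed

text \<open>Balancing puts a label of the type at the head of the channel, and the process accepts
  at least the labels of the type; so \<open>p\<close> has exactly one move, the reading of this
  head.\<close>

lemma sound_typing_GIn:
  assumes "sound_typing (GIn q p Gs) (N, M)"
  shows "enabled p (N, M)"
    and "play \<beta> = p \<Longrightarrow> session_step (N, M) \<beta> (N', M') \<Longrightarrow>
      \<exists>l G. \<beta> = InC q p l \<and> fmlookup Gs l = Some G \<and> sound_typing G (N', M') \<and> M = queue_cons (q, l, p) M'"
proof -
  have "typed (GIn q p Gs) N" "balanced (GIn q p Gs) M"
    using assms unfolding sound_typing_def by auto
  then obtain Ps h G K where Ps: "N p = Recv q Ps" "fmdom Gs |\<subseteq>| fmdom Ps"
    and ty: "\<And>l G P. fmlookup Gs l = Some G \<Longrightarrow> fmlookup Ps l = Some P \<Longrightarrow> typed G (N(p := P))"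
    and h: "M = queue_cons (q, h, p) K" "fmlookup Gs h = Some G" "balanced G K"
    by (auto elim!: typed.cases[of "GIn q p Gs"] balanced.cases[of "GIn q p Gs"])
  obtain P where P: "fmlookup Ps h = Some P"
    using Ps(2) h(2) by (metis fmdomI fmdomE fsubsetD)
  then show "enabled p (N, M)"
    using enabledI[OF step_in[of N p q Ps h P K]] Ps(1) h(1) by simp
  assume "play \<beta> = p" "session_step (N, M) \<beta> (N', M')"
  then have b: "\<beta> = InC q p h" "N' = N(p := P)" "M' = K"
    using Ps(1) P h(1) by (cases \<beta>; auto simp: session_step_iffs queue_cons_eq_iff)+
  then have "sound_typing G (N', M')"
    using sound_typing_branch[OF assms, of h G "(N', M')"] ty[OF h(2) P] h by simp
  then show "\<exists>l G. \<beta> = InC q p l \<and> fmlookup Gs l = Some G \<and> sound_typing G (N', M') \<and>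
      M = queue_cons (q, l, p) M'"
    using b h by blast
qed

text \<open>The typing rules equate the players of the network and those of any branch, apart from
  the player of the root, which plays in \<open>G\<close> anyway; hence one branch suffices.\<close>

lemma sound_typing_plays_net_subset:
  assumes "sound_typing G (N, M)"
  shows "plays_net N \<subseteq> plays G"
proof (cases "G = End")
  case True
  then show ?thesis
    using sound_typing_End assms by (fastforce simp: plays_net_def)
next
  case False
  obtain l G' where G': "fmlookup (gbranches G) l = Some G'"
    using sound_typing_nonempty assms False by blast
  have sub: "plays G' \<subseteq> plays G"
    using plays_in_branch[OF G'] unfolding plays_def by blast
  have "typed G N"
    using assms unfolding sound_typing_def by simp
  then show ?thesis
  proof cases
    case (typed_Out p q Ps Gs)
    then obtain P where "fmlookup Ps l = Some P"
      using fmdomI[OF G'] by auto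
    then have "plays_net N - {p} = plays G' - {p}"
      using typed_Out G' by auto
    moreover have "p \<in> plays G"
      using typed_Out(1) by (simp add: plays_def plays_in_GOut)
    ultimately show ?thesis
      using sub by blast
  next
    case (typed_In p q Ps Gs)
    then have "l |\<in>| fmdom Ps"
      using fmdomI[OF G'] by (simp add: fsubsetD)
    then obtain P where "fmlookup Ps l = Some P"
      by (rule fmdomE)
    then have "plays_net N - {p} = plays G' - {p}"
      using typed_In G' by auto
    moreover have "p \<in> plays G"
      using typed_In(1) by (simp add: plays_def plays_in_GIn)
    ultimately show ?thesis
      using sub by blast
  qed (simp add: plays_net_def)
qed

section \<open>Paths of a global type and depths along them\<close>

primcorec some_path :: "('p, 'l) gtype \<Rightarrow> ('p, 'l) comm path" where
  "some_path G = (case G of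
      End \<Rightarrow> Stop
    | GOut p q Gs \<Rightarrow> Step (OutC p q (SOME l. l |\<in>| fmdom Gs))
        (some_path (the (fmlookup Gs (SOME l. l |\<in>| fmdom Gs))))
    | GIn p q Gs \<Rightarrow> Step (InC p q (SOME l. l |\<in>| fmdom Gs))
        (some_path (the (fmlookup Gs (SOME l. l |\<in>| fmdom Gs)))))"

text \<open>Since choices are nonempty, some path always exists. Without one, a bound on the depth
  along all paths would hold vacuously and could not be decreased.\<close>

lemma is_path_some_path:
  assumes "\<forall>H. subtype G H \<longrightarrow> H \<noteq> End \<longrightarrow> gbranches H \<noteq> fmempty"
  shows "is_path G (some_path G)"
  using assms
proof (coinduction arbitrary: G)
  case is_path
  have some: "\<exists>G'. fmlookup (gbranches G) (SOME l. l |\<in>| fmdom (gbranches G)) = Some G' \<and>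
    (\<forall>H. subtype G' H \<longrightarrow> H \<noteq> End \<longrightarrow> gbranches H \<noteq> fmempty)" if "G \<noteq> End"
  proof -
    have "gbranches G \<noteq> fmempty"
      using is_path that subtype_refl by blast
    then have "\<exists>l. l |\<in>| fmdom (gbranches G)"
      by (metis fmap_ext fmdom_notD fmempty_lookup)
    then have "(SOME l. l |\<in>| fmdom (gbranches G)) |\<in>| fmdom (gbranches G)"
      by (rule someI_ex)
    then obtain G' where G': "fmlookup (gbranches G) (SOME l. l |\<in>| fmdom (gbranches G)) = Some G'"
      by (rule fmdomE)
    then have "\<forall>H. subtype G' H \<longrightarrow> H \<noteq> End \<longrightarrow> gbranches H \<noteq> fmempty"
      using is_path subtype_branch[OF G'] by blast
    with G' show ?thesis
      by blast
  qed
  show ?case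
  proof (cases G)
    case End
    then show ?thesis
      by (subst some_path.code) simp
  next
    case (GOut p q Gs)
    then show ?thesis
      using some by (subst some_path.code) auto
  next
    case (GIn p q Gs)
    then show ?thesis
      using some by (subst some_path.code) auto
  qed
qed

lemma path_depth_Stop: "path_depth Stop p = \<infinity>"
proof -
  have "path_at (Stop :: ('a, 'b) comm path) n = None" for n
    by (cases n) auto
  then show ?thesis
    unfolding path_depth_def by (simp add: Inf_enat_def)
qed

text \<open>A finite infimum of naturals is attained; the strict bound \<open>Suc d\<close> is what
  exhibits an element of the set.\<close>

lemma path_depth_le_enat:
  "path_depth \<xi> p \<le> enat d \<longleftrightarrow> (\<exists>n\<le>d. \<exists>\<beta>. path_at \<xi> n = Some \<beta> \<and> play \<beta> = p)"
    (is "_ \<longleftrightarrow> ?R")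
proof
  let ?A = "{enat n | n. \<exists>\<beta>. path_at \<xi> n = Some \<beta> \<and> play \<beta> = p}"
  assume le: "path_depth \<xi> p \<le> enat d"
  then have "Inf ?A < enat (Suc d)"
    unfolding path_depth_def by (rule le_less_trans) simp
  then obtain x where "x \<in> ?A" "x < enat (Suc d)"
    unfolding Inf_less_iff by blast
  then obtain n \<beta> where "n < Suc d" "path_at \<xi> n = Some \<beta>" "play \<beta> = p"
    by auto
  then show ?R
    using less_Suc_eq_le by blast
next
  assume ?R
  then obtain n where "n \<le> d" "\<exists>\<beta>. path_at \<xi> n = Some \<beta> \<and> play \<beta> = p"
    by blast
  then have "path_depth \<xi> p \<le> enat n"
    unfolding path_depth_def by (intro Inf_lower) blast
  then show "path_depth \<xi> p \<le> enat d"
    using \<open>n \<le> d\<close> by (meson enat_ord_simps(1) order_trans)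
qed

lemma path_depth_Step_le:
  "path_depth (Step \<beta> \<xi>) p \<le> enat d \<Longrightarrow> play \<beta> \<noteq> p \<Longrightarrow>
    \<exists>d'. d = Suc d' \<and> path_depth \<xi> p \<le> enat d'"
proof -
  assume "path_depth (Step \<beta> \<xi>) p \<le> enat d" "play \<beta> \<noteq> p"
  then obtain n \<gamma> where n: "n \<le> d" "path_at (Step \<beta> \<xi>) n = Some \<gamma>" "play \<gamma> = p" "play \<beta> \<noteq> p"
    unfolding path_depth_le_enat by blast
  then obtain n' where "n = Suc n'"
    by (cases n) auto
  then show ?thesis
    using n by (cases d) (auto simp: path_depth_le_enat)
qed

text \<open>The type serves as the tree, with the player of its root moving at each node, by
  induction on the depth bound \<open>d\<close>. If that player is not \<open>r\<close>, every path
  of a branch, prefixed with the communication, is a path of \<open>G\<close>, so the bound drops by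
  one.\<close>

lemma inevitable_player:
  assumes "sound_typing G (N, M)" "\<And>\<xi>. is_path G \<xi> \<Longrightarrow> path_depth \<xi> r \<le> enat d"
  shows "inevitable {S. \<exists>G. sound_typing G S} {\<beta>. play \<beta> = r} (N, M)" (is "inevitable ?X ?B _")
  using assms
proof (induction d arbitrary: G N M rule: less_induct)
  case (less d)
  have path: "is_path H (some_path H)" if "sound_typing H S" for H S
    using is_path_some_path that unfolding sound_typing_def by blast
  show ?case
  proof (cases G)
    case End
    \<comment> \<open>The only path of \<open>End\<close> is \<open>Stop\<close>, of infinite depth,
      which no \<open>d\<close> bounds.\<close>
    then show ?thesis
      using less.prems(2)[of Stop] by (simp add: is_path_End path_depth_Stop)
  next
    case (GOut p q Gs)
    show ?thesis
    proof (rule inevitable.inevitableI)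
      show "enabled p (N, M)"
        using sound_typing_GOut(1)[OF less.prems(1)[unfolded GOut]] .
    next
      fix \<beta> S'
      assume b: "play \<beta> = p" "session_step (N, M) \<beta> S'"
      obtain N' M' where S': "S' = (N', M')"
        by (cases S')
      obtain l H where H: "\<beta> = OutC p q l" "fmlookup Gs l = Some H" "sound_typing H (N', M')"
        using sound_typing_GOut(2)[OF less.prems(1)[unfolded GOut] b(1)] b(2) S' by blast
      have "inevitable ?X ?B (N', M')" if "p \<noteq> r"
      proof -
        have *: "\<exists>d'. d = Suc d' \<and> path_depth \<xi> r \<le> enat d'" if "is_path H \<xi>" for \<xi>
          using path_depth_Step_le[of \<beta> \<xi> r d] less.prems(2) is_path_GOut[OF H(2) that] GOut \<open>p \<noteq> r\<close> H(1)
          by simp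
        \<comment> \<open>\<open>some_path H\<close> shows that \<open>d\<close> is positive, so
          that \<open>d'\<close> exists independently of the path.\<close>
        then obtain d' where "d = Suc d'"
          using path[OF H(3)] by blast
        then show ?thesis
          using less.IH[of d' H N' M'] * H(3) by auto
      qed
      then show "S' \<in> ?X \<and> (\<beta> \<in> ?B \<or> inevitable ?X ?B S')"
        using S' H b by blast
    qed
  next
    case (GIn q p Gs)
    show ?thesis
    proof (rule inevitable.inevitableI)
      show "enabled p (N, M)"
        using sound_typing_GIn(1)[OF less.prems(1)[unfolded GIn]] .
    next
      fix \<beta> S'
      assume b: "play \<beta> = p" "session_step (N, M) \<beta> S'"
      obtain N' M' where S': "S' = (N', M')"
        by (cases S')
      obtain l H where H: "\<beta> = InC q p l" "fmlookup Gs l = Some H" "sound_typing H (N', M')"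
        using sound_typing_GIn(2)[OF less.prems(1)[unfolded GIn] b(1)] b(2) S' by blast
      have "inevitable ?X ?B (N', M')" if "p \<noteq> r"
      proof -
        have *: "\<exists>d'. d = Suc d' \<and> path_depth \<xi> r \<le> enat d'" if "is_path H \<xi>" for \<xi>
          using path_depth_Step_le[of \<beta> \<xi> r d] less.prems(2) is_path_GIn[OF H(2) that] GIn \<open>p \<noteq> r\<close> H(1)
          by simp
        then obtain d' where "d = Suc d'"
          using path[OF H(3)] by blast
        then show ?thesis
          using less.IH[of d' H N' M'] * H(3) by auto
      qed
      then show "S' \<in> ?X \<and> (\<beta> \<in> ?B \<or> inevitable ?X ?B S')"
        using S' H b by blast
    qed
  qed
qed

text \<open>\<open>K\<close> is what remains of the initial queue once the messages sent along the tree are left out;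
  only this part is controlled by readability.\<close>

lemma inevitable_message:
  assumes "readable G K" "sound_typing G (N, M)" "\<And>a b. \<exists>ls. chan M a b = chan K a b @ ls"
    "chan K p q = l # ks"
  shows "inevitable {S. \<exists>G. sound_typing G S} {InC p q l} (N, M)" (is "inevitable ?X ?B _")
  using assms
proof (induction arbitrary: N M ks)
  case (readable_empty G)
  then show ?case
    by simp
next
  case (readable_Out Gs K a b)
  show ?case
  proof (rule inevitable.inevitableI)
    show "enabled a (N, M)"
      using sound_typing_GOut(1)[OF readable_Out.prems(1)] .
  next
    fix \<beta> S'
    assume b: "play \<beta> = a" "session_step (N, M) \<beta> S'"
    obtain N' M' where S': "S' = (N', M')"
      by (cases S')
    obtain k H where H: "fmlookup Gs k = Some H" "sound_typing H (N', M')" "M' = enqueue M (a, k, b)"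
      using sound_typing_GOut(2)[OF readable_Out.prems(1) b(1)] b(2) S' by blast
    have "\<exists>ls. chan M' c d = chan K c d @ ls" for c d
      using readable_Out.prems(2)[of c d] H(3) by auto
    then have "inevitable ?X ?B (N', M')"
      using readable_Out.IH H readable_Out.prems(3) by blast
    then show "S' \<in> ?X \<and> (\<beta> \<in> ?B \<or> inevitable ?X ?B S')"
      using S' H by blast
  qed
next
  case (readable_In h Gs K a b)
  show ?case
  proof (rule inevitable.inevitableI)
    show "enabled b (N, M)"
      using sound_typing_GIn(1)[OF readable_In.prems(1)] .
  next
    fix \<beta> S'
    assume b: "play \<beta> = b" "session_step (N, M) \<beta> S'"
    obtain N' M' where S': "S' = (N', M')"
      by (cases S')
    obtain k H where H: "\<beta> = InC a b k" "fmlookup Gs k = Some H" "sound_typing H (N', M')"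
      "M = queue_cons (a, k, b) M'"
      using sound_typing_GIn(2)[OF readable_In.prems(1) b(1)] b(2) S' by blast
    \<comment> \<open>The channel of \<open>K\<close> is a prefix of that of \<open>M\<close>, so
      the message read is the one that readability foresees.\<close>
    have k: "k = h"
      using readable_In.prems(2)[of a b] H(4) by auto
    have pre: "\<exists>ls. chan M' c d = chan K c d @ ls" for c d
      using readable_In.prems(2)[of c d] H(4) by (auto split: if_splits)
    have "\<beta> \<in> ?B \<or> inevitable ?X ?B (N', M')"
    proof (cases "a = p \<and> b = q")
      case True
      then show ?thesis
        using readable_In.prems(3) H(1) k by simp
    next
      case False
      then have "chan K p q = l # ks"
        using readable_In.prems(3) by (auto split: if_splits)
      then show ?thesis
        using readable_In.IH H pre by blast
    qed
    then show "S' \<in> ?X \<and> (\<beta> \<in> ?B \<or> inevitable ?X ?B S')"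
      using S' H by blast
  qed
next
  case (readable_In_skip Gs K a b)
  show ?case
  proof (rule inevitable.inevitableI)
    show "enabled b (N, M)"
      using sound_typing_GIn(1)[OF readable_In_skip.prems(1)] .
  next
    fix \<beta> S'
    assume b: "play \<beta> = b" "session_step (N, M) \<beta> S'"
    obtain N' M' where S': "S' = (N', M')"
      by (cases S')
    obtain k H where H: "\<beta> = InC a b k" "fmlookup Gs k = Some H" "sound_typing H (N', M')"
      "M = queue_cons (a, k, b) M'"
      using sound_typing_GIn(2)[OF readable_In_skip.prems(1) b(1)] b(2) S' by blast
    \<comment> \<open>A head of this channel in \<open>K\<close> would be the head in
      \<open>M\<close> as well, thus carry the label \<open>k\<close> of the type, which the case
      excludes. So the message read does not belong to \<open>K\<close>, and \<open>K\<close> is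
      kept.\<close>
    have "chan K a b = []"
    proof (cases "chan K a b")
      case (Cons k' ls)
      then have "k' = k"
        using readable_In_skip.prems(2)[of a b] H(4) by auto
      then obtain K' where "K = queue_cons (a, k, b) K'"
        using Cons chan_eq_Cons_imp_queue_cons by metis
      then show ?thesis
        using readable_In_skip.hyps H(2) by (auto intro: fmdomI)
    qed
    then have "\<exists>ls. chan M' c d = chan K c d @ ls" for c d
      using readable_In_skip.prems(2)[of c d] H(4) by (auto split: if_splits)
    then have "inevitable ?X ?B (N', M')"
      using readable_In_skip.IH H readable_In_skip.prems(3) by blast
    then show "S' \<in> ?X \<and> (\<beta> \<in> ?B \<or> inevitable ?X ?B S')"
      using S' H by blast
  qed
qed

lemma balanced_readable: "balanced G M \<Longrightarrow> readable G M"
  by (auto elim: balanced.cases intro: readable_empty)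

lemma sound_typing_persistent: "persistent {S. \<exists>G. sound_typing G S}"
  unfolding persistent_def
proof (intro ballI allI impI)
  fix S :: "('p, 'l) session" and B
  assume "S \<in> {S. \<exists>G. sound_typing G S}" "pending S B"
  then obtain G where G: "sound_typing G S"
    by blast
  show "inevitable {S. \<exists>G. sound_typing G S} B S"
    using \<open>pending S B\<close>
  proof cases
    case (pending_player N p M)
    then have p: "p \<in> plays G"
      using sound_typing_plays_net_subset G unfolding plays_net_def by blast
    then have "depth G p < \<infinity>"
      using G subtype_refl unfolding sound_typing_def bounded_gtype_def by blast
    then have "Sup {path_depth \<xi> p | \<xi>. is_path G \<xi>} \<noteq> \<infinity>"
      using p unfolding depth_def by (intro notI) simp
    then obtain d where "Sup {path_depth \<xi> p | \<xi>. is_path G \<xi>} = enat d"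
      by auto
    then have depth: "path_depth \<xi> p \<le> enat d" if "is_path G \<xi>" for \<xi>
      using that by (metis (mono_tags, lifting) Sup_upper mem_Collect_eq)
    show ?thesis
      using inevitable_player[OF _ depth, of G N M] G pending_player by simp
  next
    case (pending_message N p l q M)
    then have "readable G (snd S)"
      using G balanced_readable unfolding sound_typing_def by blast
    \<comment> \<open>At the root nothing has been sent along the tree, so \<open>K\<close> is the
      whole queue.\<close>
    then show ?thesis
      using inevitable_message[of G "snd S" N "snd S" p q l "chan M p q"] G pending_message by simp
  qed
qed

theorem theorem4p20:
  fixes G :: "('p, 'l) gtype" and N :: "('p, 'l) network" and M :: "('p, 'l) queue"
  assumes "wf_gtype G" and "wf_network N"
    and "typed G N" and "bounded_gtype G" and "balanced G M"
  shows "progress (N, M)"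
proof -
  have "gbranches H \<noteq> fmempty" if "subtype G H" "H \<noteq> End" for H
    using assms(1) that unfolding wf_gtype_def by (cases H) auto
  then have "sound_typing G (N, M)"
    using assms unfolding sound_typing_def by simp
  then have "live (N, M)"
    using sound_typing_persistent unfolding live_def by blast
  then show ?thesis
    by (rule live_progress)
qed

end
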